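(* Let $\{(\mathbf{y}^k,\alpha_k,\lambda_k)\}_{k\ge0}$ be the sequence generated by the geometric proximal gradient algorithm (described in the context), with $\lim_{k\to\infty}\lambda_k=\lambda_*$. Then any accumulation point of $\{\mathbf{y}^k\}$ is a critical point of $F(\lambda_*,\cdot)$.
   Context: Setting: $A\in\mathbb{R}^{m\times n}$, $\mathbf{b}\in\mathbb{R}^m$; $\mathcal{S}^{n-1}=\{\mathbf{y}\in\mathbb{R}^n:\mathbf{y}^T\mathbf{y}=1\}$; $\odot$ is the entrywise product; $\|\cdot\|$ is the Euclidean norm and $\|\mathbf{y}\|_1=\sum_j|y_j|$. Define $f(\mathbf{y})=\frac12\|A(\mathbf{y}\odot\mathbf{y})-\mathbf{b}\|^2$ and $F(\lambda,\mathbf{y})=f(\mathbf{y})+\lambda\|\mathbf{y}\|_1+\chi_{\mathcal{S}^{n-1}}(\mathbf{y})$, where $\chi_{\mathcal{S}^{n-1}}$ equals $0$ on $\mathcal{S}^{n-1}$ and $+\infty$ elsewhere. Algorithm. Parameters: $\mathbf{y}^0\in\mathcal{S}^{n-1}$, $\alpha_0>0$, $\lambda_0>0$, $\rho_1,\rho_2,\rho_3\in(0,1)$, $\gamma_1,\gamma_2>0$, $\delta_1,\delta_2>0$. For $k=0,1,2,\ldots$: Step 1. Set $\alpha=\alpha_0$ and let $\overline{\mathbf{y}}^k$ be a global minimizer over $\mathbf{y}\in\mathcal{S}^{n-1}$ of $f(\mathbf{y}^k)+\langle\mathbf{y}-\mathbf{y}^k,\nabla f(\mathbf{y}^k)\rangle+\frac1{2\alpha}\|\mathbf{y}-\mathbf{y}^k\|^2+\lambda_k\|\mathbf{y}\|_1$.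 Step 2. As long as the test $F(\lambda_k,\overline{\mathbf{y}}^k)\le F(\lambda_k,\mathbf{y}^k)-\frac12\gamma_2\|\overline{\mathbf{y}}^k-\mathbf{y}^k\|^2$ fails, do the following, in order: replace $\alpha$ by $\max\{\gamma_1,\alpha\rho_1\}$; if $F(\lambda_k,\overline{\mathbf{y}}^k)>\delta_1F(\lambda_k,\mathbf{y}^k)$, replace $\alpha$ by $\max\{\gamma_1,\alpha\rho_2\}$; if $|F(\lambda_k,\overline{\mathbf{y}}^k)-F(\lambda_k,\mathbf{y}^k)|<\delta_2F(\lambda_k,\mathbf{y}^k)$, replace $\lambda_k$ by $\lambda_k\rho_3$; recompute $\overline{\mathbf{y}}^k$ as a global minimizer as in Step 1 with the current $\alpha$ and $\lambda_k$. When the test holds, set $\mathbf{y}^{k+1}=\overline{\mathbf{y}}^k$, $\alpha_{k+1}=\alpha$, $\lambda_{k+1}=\lambda_k$ (the current value). It is understood that the inner loop of Step 2 terminates for every $k$, so that an infinite sequence is generated. In the sequence $\{\lambda_k\}$, $\lambda_k$ denotes the value at the start of iteration $k$. Critical point: for a proper lower semicontinuous $h:\mathbb{R}^n\to[-\infty,+\infty]$, the Fréchet subdifferential at $\bar{\mathbf{a}}\in\operatorname{dom}h$ is $\widehat\partial h(\bar{\mathbf{a}})=\{\mathbf{r}:\liminf_{\mathbf{a}\to\bar{\mathbf{a}}}\frac{h(\mathbf{a})-h(\bar{\mathbf{a}})-\langle\mathbf{r},\mathbf{a}-\bar{\mathbf{a}}\rangle}{\|\mathbf{a}-\bar{\mathbf{a}}\|}\ge0\}$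 (empty off $\operatorname{dom}h$), and the limiting subdifferential $\partial h(\bar{\mathbf{a}})$ is the set of $\mathbf{r}$ for which there are $\mathbf{a}^k\to\bar{\mathbf{a}}$ with $h(\mathbf{a}^k)\to h(\bar{\mathbf{a}})$ and $\mathbf{r}^k\in\widehat\partial h(\mathbf{a}^k)$ with $\mathbf{r}^k\to\mathbf{r}$. A point $\bar{\mathbf{a}}$ is a critical point of $h$ if $\mathbf{0}\in\partial h(\bar{\mathbf{a}})$. *)

theory Defs
  imports "HOL-Analysis.Analysis"
begin

definition edom :: "('a \<Rightarrow> ereal) \<Rightarrow> 'a set" where
  "edom h = {a. h a < \<infinity>}"

text \<open>The filter \<open>at a\<close> is punctured, so the quotient is never evaluated at \<open>x = a\<close>.\<close>

definition frechet_subdiff :: "('a::real_inner \<Rightarrow> ereal) \<Rightarrow> 'a \<Rightarrow> 'a set" where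
  "frechet_subdiff h a =
    (if a \<in> edom h
     then {r. Liminf (at a) (\<lambda>x. (h x - h a - ereal (r \<bullet> (x - a))) / ereal (norm (x - a))) \<ge> 0}
     else {})"

definition limiting_subdiff :: "('a::real_inner \<Rightarrow> ereal) \<Rightarrow> 'a \<Rightarrow> 'a set" where
  "limiting_subdiff h a =
    (if a \<in> edom h
     then {r. \<exists>as rs. as \<longlonglongrightarrow> a \<and> (\<lambda>k. h (as k)) \<longlonglongrightarrow> h a \<and>
              (\<forall>k. rs k \<in> frechet_subdiff h (as k)) \<and> rs \<longlonglongrightarrow> r}
     else {})"

definition critical_point :: "('a::real_inner \<Rightarrow> ereal) \<Rightarrow> 'a \<Rightarrow> bool" where
  "critical_point h a \<longleftrightarrow> 0 \<in> limiting_subdiff h a"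

definition chi_set :: "'a set \<Rightarrow> 'a \<Rightarrow> ereal" where
  "chi_set S y = (if y \<in> S then 0 else \<infinity>)"

definition norm1 :: "real ^ 'n \<Rightarrow> real" where
  "norm1 y = (\<Sum>j\<in>UNIV. \<bar>y $ j\<bar>)"

definition grad :: "('a::real_inner \<Rightarrow> real) \<Rightarrow> 'a \<Rightarrow> 'a" where
  "grad g x = (THE D. GDERIV g x :> D)"

text \<open>Multiplication on \<open>real ^ 'n\<close> is the entrywise product.\<close>

definition fobj :: "real ^ 'n ^ 'm \<Rightarrow> real ^ 'm \<Rightarrow> real ^ 'n \<Rightarrow> real" where
  "fobj A b y = 1 / 2 * (norm (A *v (y * y) - b))\<^sup>2"

definition Fobj :: "real ^ 'n ^ 'm \<Rightarrow> real ^ 'm \<Rightarrow> real \<Rightarrow> real ^ 'n \<Rightarrow> ereal" where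
  "Fobj A b lam y = ereal (fobj A b y + lam * norm1 y) + chi_set (sphere 0 1) y"

definition prox_model ::
  "real ^ 'n ^ 'm \<Rightarrow> real ^ 'm \<Rightarrow> real ^ 'n \<Rightarrow> real \<Rightarrow> real \<Rightarrow> real ^ 'n \<Rightarrow> real" where
  "prox_model A b yk \<alpha> lam y =
     fobj A b yk + (y - yk) \<bullet> grad (fobj A b) yk
     + 1 / (2 * \<alpha>) * (norm (y - yk))\<^sup>2 + lam * norm1 y"

definition prox_minimizer ::
  "real ^ 'n ^ 'm \<Rightarrow> real ^ 'm \<Rightarrow> real ^ 'n \<Rightarrow> real \<Rightarrow> real \<Rightarrow> real ^ 'n \<Rightarrow> bool" where
  "prox_minimizer A b yk \<alpha> lam ybar \<longleftrightarrow>
     is_arg_min (prox_model A b yk \<alpha> lam) (\<lambda>y. y \<in> sphere 0 1) ybar"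

definition accept_test ::
  "real ^ 'n ^ 'm \<Rightarrow> real ^ 'm \<Rightarrow> real \<Rightarrow> real ^ 'n \<Rightarrow> real \<Rightarrow> real ^ 'n \<Rightarrow> bool" where
  "accept_test A b \<gamma>2 yk lam ybar \<longleftrightarrow>
     Fobj A b lam ybar \<le> Fobj A b lam yk - ereal (1 / 2 * \<gamma>2 * (norm (ybar - yk))\<^sup>2)"

definition next_alpha ::
  "real ^ 'n ^ 'm \<Rightarrow> real ^ 'm \<Rightarrow> real \<Rightarrow> real \<Rightarrow> real \<Rightarrow> real
    \<Rightarrow> real ^ 'n \<Rightarrow> real \<Rightarrow> real \<Rightarrow> real ^ 'n \<Rightarrow> real" where
  "next_alpha A b \<rho>1 \<rho>2 \<gamma>1 \<delta>1 yk \<alpha> lam ybar =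
     (let \<alpha>' = max \<gamma>1 (\<alpha> * \<rho>1)
      in if Fobj A b lam ybar > ereal \<delta>1 * Fobj A b lam yk then max \<gamma>1 (\<alpha>' * \<rho>2) else \<alpha>')"

definition next_lambda ::
  "real ^ 'n ^ 'm \<Rightarrow> real ^ 'm \<Rightarrow> real \<Rightarrow> real
    \<Rightarrow> real ^ 'n \<Rightarrow> real \<Rightarrow> real ^ 'n \<Rightarrow> real" where
  "next_lambda A b \<rho>3 \<delta>2 yk lam ybar =
     (if \<bar>Fobj A b lam ybar - Fobj A b lam yk\<bar> < ereal \<delta>2 * Fobj A b lam yk
      then lam * \<rho>3 else lam)"

text \<open>
  \<open>inner_state \<dots> yk lamk \<alpha> lam ybar\<close>: during one iteration started from \<open>yk\<close> and \<open>lamk\<close>, the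
  working variables can take the values \<open>\<alpha>\<close>, \<open>lam\<close>, \<open>ybar\<close> just before an evaluation of the
  acceptance test. It is a relation since global minimizers need not be unique. The loop body runs
  only when the test fails, so no state follows an accepted one.
\<close>

inductive inner_state ::
  "real ^ 'n ^ 'm \<Rightarrow> real ^ 'm \<Rightarrow> real \<Rightarrow> real \<Rightarrow> real \<Rightarrow> real \<Rightarrow> real \<Rightarrow> real \<Rightarrow> real
    \<Rightarrow> real \<Rightarrow> real ^ 'n \<Rightarrow> real \<Rightarrow> real \<Rightarrow> real \<Rightarrow> real ^ 'n \<Rightarrow> bool"
  for A b \<rho>1 \<rho>2 \<rho>3 \<gamma>1 \<gamma>2 \<delta>1 \<delta>2 \<alpha>0 yk lamk
where
  start: "prox_minimizer A b yk \<alpha>0 lamk ybar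
    \<Longrightarrow> inner_state A b \<rho>1 \<rho>2 \<rho>3 \<gamma>1 \<gamma>2 \<delta>1 \<delta>2 \<alpha>0 yk lamk \<alpha>0 lamk ybar"
| repeat: "\<lbrakk>inner_state A b \<rho>1 \<rho>2 \<rho>3 \<gamma>1 \<gamma>2 \<delta>1 \<delta>2 \<alpha>0 yk lamk \<alpha> lam ybar;
     \<not> accept_test A b \<gamma>2 yk lam ybar;
     \<alpha>' = next_alpha A b \<rho>1 \<rho>2 \<gamma>1 \<delta>1 yk \<alpha> lam ybar;
     lam' = next_lambda A b \<rho>3 \<delta>2 yk lam ybar;
     prox_minimizer A b yk \<alpha>' lam' ybar'\<rbrakk>
    \<Longrightarrow> inner_state A b \<rho>1 \<rho>2 \<rho>3 \<gamma>1 \<gamma>2 \<delta>1 \<delta>2 \<alpha>0 yk lamk \<alpha>' lam' ybar'"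

text \<open>
  The parameters \<open>y\<^sup>0\<close>, \<open>\<alpha>\<^sub>0\<close>, \<open>\<lambda>\<^sub>0\<close> are the initial terms of the sequences. Every iteration
  restarts from \<open>alpha 0\<close>, not from \<open>alpha k\<close>. Termination of each inner loop is the existence of
  an accepted state that yields the next terms.
\<close>

definition gpga_sequence ::
  "real ^ 'n ^ 'm \<Rightarrow> real ^ 'm \<Rightarrow> real \<Rightarrow> real \<Rightarrow> real \<Rightarrow> real \<Rightarrow> real \<Rightarrow> real \<Rightarrow> real
    \<Rightarrow> (nat \<Rightarrow> real ^ 'n) \<Rightarrow> (nat \<Rightarrow> real) \<Rightarrow> (nat \<Rightarrow> real) \<Rightarrow> bool" where
  "gpga_sequence A b \<rho>1 \<rho>2 \<rho>3 \<gamma>1 \<gamma>2 \<delta>1 \<delta>2 y alpha lambda \<longleftrightarrow>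
     y 0 \<in> sphere 0 1 \<and> alpha 0 > 0 \<and> lambda 0 > 0 \<and>
     (\<forall>k. inner_state A b \<rho>1 \<rho>2 \<rho>3 \<gamma>1 \<gamma>2 \<delta>1 \<delta>2 (alpha 0) (y k) (lambda k)
            (alpha (Suc k)) (lambda (Suc k)) (y (Suc k)) \<and>
          accept_test A b \<gamma>2 (y k) (lambda (Suc k)) (y (Suc k)))"

definition accumulation_point :: "(nat \<Rightarrow> 'a::topological_space) \<Rightarrow> 'a \<Rightarrow> bool" where
  "accumulation_point x p \<longleftrightarrow> (\<exists>r. strict_mono r \<and> (x \<circ> r) \<longlonglongrightarrow> p)"

end

theory Submission
  imports Defs
begin

text \<open>
  The accepted step decreases \<open>F(\<lambda>\<^sub>k, y\<^sup>k)\<close> by at least \<open>\<gamma>\<^sub>2 \<parallel>y\<^sup>k\<^sup>+\<^sup>1 - y\<^sup>k\<parallel>\<^sup>2 / 2\<close>, and lowering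
  \<open>\<lambda>\<close> decreases it further; as \<open>F \<ge> 0\<close>, consecutive iterates approach each other. The step sizes
  stay above \<open>min \<alpha>\<^sub>0 \<gamma>\<^sub>1\<close>, so the minimality inequalities of the proximal models can be relaxed to
  a common quadratic constant \<open>c\<close> and then passed to the limit along a subsequence: on the sphere
  \<open>\<lambda>\<^sub>* \<parallel>y\<^sub>*\<parallel>\<^sub>1 \<le> \<langle>y - y\<^sub>*, \<nabla>f(y\<^sub>*)\<rangle> + c \<parallel>y - y\<^sub>*\<parallel>\<^sup>2 + \<lambda>\<^sub>* \<parallel>y\<parallel>\<^sub>1\<close>. Since \<open>c \<parallel>y - y\<^sub>*\<parallel>\<^sup>2\<close> is of second order, zero is
  already a Frechet subgradient at \<open>y\<^sub>*\<close>. Subgradients at the iterates themselves would not do,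
  because these belong to \<open>F(\<lambda>\<^sub>k, \<cdot>)\<close> rather than to \<open>F(\<lambda>\<^sub>*, \<cdot>)\<close>.
\<close>

lemma frechet_subdiff_imp_limiting_subdiff:
  assumes "r \<in> frechet_subdiff h a"
  shows "r \<in> limiting_subdiff h a"
proof -
  have "a \<in> edom h"
    using assms by (auto simp: frechet_subdiff_def split: if_splits)
  moreover have "\<exists>as rs. as \<longlonglongrightarrow> a \<and> (\<lambda>k. h (as k)) \<longlonglongrightarrow> h a \<and>
      (\<forall>k. rs k \<in> frechet_subdiff h (as k)) \<and> rs \<longlonglongrightarrow> r"
    using assms by (intro exI[of _ "\<lambda>_. a"] exI[of _ "\<lambda>_. r"]) auto
  ultimately show ?thesis
    by (simp add: limiting_subdiff_def)
qed

lemma grad_eqI: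
  assumes "GDERIV g x :> D"
  shows "grad g x = D"
  unfolding grad_def
proof (rule the_equality)
  show "GDERIV g x :> D"
    by (rule assms)
next
  fix E
  assume "GDERIV g x :> E"
  then have "(\<lambda>h. inner h E) = (\<lambda>h. inner h D)"
    using assms unfolding gderiv_def by (rule has_derivative_unique)
  then have "inner (E - D) E = inner (E - D) D"
    by metis
  then have "inner (E - D) (E - D) = 0"
    by (simp add: inner_diff_right)
  then show "E = D"
    by simp
qed

text \<open>In coordinates the objective is a polynomial, within reach of the derivative rules for
  sums and powers.\<close>

lemma fobj_eq_sum:
  "fobj A b y = 1/2 * (\<Sum>i\<in>UNIV. ((\<Sum>j\<in>UNIV. A $ i $ j * (y $ j)\<^sup>2) - b $ i)\<^sup>2)"
  unfolding fobj_def dot_square_norm[symmetric] inner_vec_def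
  by (simp add: matrix_vector_mult_def power2_eq_square)

lemma gderiv_fobj:
  "GDERIV (fobj A b) y :> 2 *\<^sub>R (y * (transpose A *v (A *v (y * y) - b)))"
proof -
  have der: "(fobj A b has_derivative
      (\<lambda>h. 1/2 * (\<Sum>i\<in>UNIV. 2 * (\<Sum>j\<in>UNIV. A $ i $ j * (2 * (h $ j) * y $ j))
          * ((\<Sum>j\<in>UNIV. A $ i $ j * (y $ j)\<^sup>2) - b $ i)))) (at y)"
    unfolding fobj_eq_sum[abs_def]
    by (auto intro!: derivative_eq_intros bounded_linear.has_derivative[OF bounded_linear_vec_nth]
        sum.cong simp: algebra_simps)
  have "1/2 * (\<Sum>i\<in>UNIV. 2 * (\<Sum>j\<in>UNIV. A $ i $ j * (2 * (h $ j) * y $ j))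
          * ((\<Sum>j\<in>UNIV. A $ i $ j * (y $ j)\<^sup>2) - b $ i))
        = inner h (2 *\<^sub>R (y * (transpose A *v (A *v (y * y) - b))))" for h
  proof -
    define r where "r i = (\<Sum>j\<in>UNIV. A $ i $ j * (y $ j)\<^sup>2) - b $ i" for i
    have "inner h (2 *\<^sub>R (y * (transpose A *v (A *v (y * y) - b))))
        = (\<Sum>j\<in>UNIV. \<Sum>i\<in>UNIV. 2 * h $ j * y $ j * (A $ i $ j * r i))"
      unfolding inner_vec_def
      by (intro sum.cong refl)
         (simp add: matrix_vector_mult_def transpose_def r_def power2_eq_square
           sum_distrib_left algebra_simps)
    \<comment> \<open>Exchanging the sums trades \<open>transpose A\<close> acting on the residual
      for \<open>A\<close> acting on the direction.\<close>
    also have "\<dots> = (\<Sum>i\<in>UNIV. \<Sum>j\<in>UNIV. 2 * h $ j * y $ j * (A $ i $ j * r i))"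
      by (rule sum.swap)
    also have "\<dots> = 1/2 * (\<Sum>i\<in>UNIV. 2 * (\<Sum>j\<in>UNIV. A $ i $ j * (2 * (h $ j) * y $ j)) * r i)"
      unfolding sum_distrib_left sum_distrib_right
      by (intro sum.cong refl) (simp add: algebra_simps)
    finally show ?thesis
      by (simp add: r_def)
  qed
  with der show ?thesis
    by (simp add: gderiv_def)
qed

lemma grad_fobj:
  "grad (fobj A b) y = 2 *\<^sub>R (y * (transpose A *v (A *v (y * y) - b)))"
  by (rule grad_eqI[OF gderiv_fobj])

lemma isCont_grad_fobj: "isCont (grad (fobj A b)) y"
proof -
  have "((\<lambda>y. 2 *\<^sub>R (y * (transpose A *v (A *v (y * y) - b))))
      \<longlongrightarrow> 2 *\<^sub>R (y * (transpose A *v (A *v (y * y) - b)))) (at y)"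
    by (rule vec_tendstoI) (auto intro!: tendsto_intros simp: matrix_vector_mult_def)
  then show ?thesis
    by (simp add: isCont_def grad_fobj[abs_def])
qed

lemma tendsto_norm1:
  assumes "(f \<longlongrightarrow> l) F"
  shows "((\<lambda>x. norm1 (f x)) \<longlongrightarrow> norm1 l) F"
  unfolding norm1_def using assms by (auto intro!: tendsto_intros)

lemma norm1_nonneg: "norm1 y \<ge> 0"
  by (simp add: norm1_def sum_nonneg)

lemma Fobj_on_sphere:
  "y \<in> sphere 0 1 \<Longrightarrow> Fobj A b lam y = ereal (fobj A b y + lam * norm1 y)"
  by (simp add: Fobj_def chi_set_def)

text \<open>On \<open>S\<close> the assumed inequality bounds the Frechet quotient below by the
  first-order remainder of \<open>f\<close> minus \<open>c * norm (x - a)\<close>, and both tend to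
  0; off \<open>S\<close> the quotient is infinite.\<close>

lemma frechet_subdiff_indicator_sum:
  fixes f g :: "'a::real_inner \<Rightarrow> real"
  assumes "a \<in> S" and f: "GDERIV f a :> D"
    and min: "\<And>x. x \<in> S \<Longrightarrow> g a \<le> (x - a) \<bullet> D + c * (norm (x - a))\<^sup>2 + g x"
  shows "0 \<in> frechet_subdiff (\<lambda>x. ereal (f x + g x) + chi_set S x) a"
proof -
  define h where "h x = ereal (f x + g x) + chi_set S x" for x
  define q where "q x = (f x - f a - (x - a) \<bullet> D) / norm (x - a) - c * norm (x - a)" for x
  have ha: "h a = ereal (f a + g a)"
    using \<open>a \<in> S\<close> by (simp add: h_def chi_set_def)
  have "((\<lambda>x. (f x - f a - (x - a) \<bullet> D) / norm (x - a)) \<longlongrightarrow> 0) (at a)"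
    using f unfolding gderiv_def has_derivative_iff_norm
    by (intro tendsto_norm_zero_cancel[of "\<lambda>x. (f x - f a - (x - a) \<bullet> D) / norm (x - a)"]) simp
  moreover have "((\<lambda>x. c * norm (x - a)) \<longlongrightarrow> 0) (at a)"
    by (auto intro!: tendsto_eq_intros)
  ultimately have "(q \<longlongrightarrow> 0) (at a)"
    unfolding q_def using tendsto_diff by fastforce
  then have "((\<lambda>x. ereal (q x)) \<longlongrightarrow> 0) (at a)"
    by (simp add: zero_ereal_def)
  then have "0 \<le> Liminf (at a) (\<lambda>x. ereal (q x))"
    \<comment> \<open>In a zero-dimensional space the punctured filter is trivial and the
      \<open>Liminf\<close> is infinite.\<close>
    by (cases "at a = bot") (auto simp: lim_imp_Liminf)
  also have "\<dots> \<le> Liminf (at a) (\<lambda>x. (h x - h a - ereal (0 \<bullet> (x - a))) / ereal (norm (x - a)))"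
  proof (rule Liminf_mono, rule eventually_at_topological[THEN iffD2], intro exI conjI ballI impI)
    show "open (UNIV :: 'a set)" "a \<in> UNIV" by auto
    fix x
    assume "x \<noteq> a"
    then have pos: "norm (x - a) > 0"
      by simp
    show "ereal (q x) \<le> (h x - h a - ereal (0 \<bullet> (x - a))) / ereal (norm (x - a))"
    proof (cases "x \<in> S")
      case True
      have "q x = (f x - f a - (x - a) \<bullet> D - c * (norm (x - a))\<^sup>2) / norm (x - a)"
        using pos by (simp add: q_def diff_divide_distrib power2_eq_square)
      also have "\<dots> \<le> (f x + g x - (f a + g a)) / norm (x - a)"
        using min[OF True] pos by (intro divide_right_mono) auto
      finally show ?thesis
        using True pos by (simp add: ha, simp add: h_def chi_set_def)
    next
      case False
      then show ?thesis
        using pos by (simp add: ha, simp add: h_def chi_set_def)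
    qed
  qed
  finally have "0 \<in> frechet_subdiff h a"
    by (simp add: frechet_subdiff_def edom_def ha)
  then show ?thesis
    by (simp only: h_def[abs_def])
qed

text \<open>Dropping the quadratic term at the minimizer and enlarging the one at \<open>z\<close>
  removes \<alpha>, so limits can be taken without convergence of the step sizes.\<close>

lemma prox_minimizer_relaxed:
  assumes "prox_minimizer A b yk \<alpha> lam ybar" "z \<in> sphere 0 1" "0 < \<beta>" "\<beta> \<le> \<alpha>"
  shows "(ybar - yk) \<bullet> grad (fobj A b) yk + lam * norm1 ybar
    \<le> (z - yk) \<bullet> grad (fobj A b) yk + 1 / (2 * \<beta>) * (norm (z - yk))\<^sup>2 + lam * norm1 z"
proof -
  have "prox_model A b yk \<alpha> lam ybar \<le> prox_model A b yk \<alpha> lam z"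
    using assms(1,2) by (auto simp: prox_minimizer_def is_arg_min_linorder)
  moreover have "0 \<le> 1 / (2 * \<alpha>) * (norm (ybar - yk))\<^sup>2"
    using assms(3,4) by simp
  moreover have "1 / (2 * \<alpha>) * (norm (z - yk))\<^sup>2 \<le> 1 / (2 * \<beta>) * (norm (z - yk))\<^sup>2"
    using assms(3,4) by (intro mult_right_mono) (auto simp: frac_le)
  ultimately show ?thesis
    unfolding prox_model_def by linarith
qed

text \<open>Every update clamps the step size at \<gamma>1, but the starting value \<alpha>0 may be
  smaller, hence the minimum.\<close>

lemma inner_state_bounds:
  assumes "inner_state A b \<rho>1 \<rho>2 \<rho>3 \<gamma>1 \<gamma>2 \<delta>1 \<delta>2 \<alpha>0 yk lamk \<alpha> lam ybar"
    and "\<rho>3 \<in> {0<..<1}" "0 < lamk"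
  shows "prox_minimizer A b yk \<alpha> lam ybar \<and> 0 < lam \<and> lam \<le> lamk \<and> min \<alpha>0 \<gamma>1 \<le> \<alpha>"
  using assms(1)
proof induction
  case start
  then show ?case
    using assms by auto
next
  case (repeat \<alpha> lam ybar \<alpha>' lam' ybar')
  have "\<gamma>1 \<le> \<alpha>'"
    using repeat by (simp add: next_alpha_def Let_def)
  moreover have "lam * \<rho>3 \<le> lamk"
    using repeat.IH assms mult_mono[of lam lamk \<rho>3 1] by simp
  then have "0 < lam'" "lam' \<le> lamk"
    using repeat assms by (auto simp: next_lambda_def)
  ultimately show ?case
    using repeat by auto
qed

text \<open>The energies decrease and are bounded below, so they converge; their consecutive
  differences, which dominate the squared steps up to the factor \<open>c\<close>, vanish.\<close>

lemma sufficient_decrease_imp_steps_vanish: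
  fixes y :: "nat \<Rightarrow> 'a::real_normed_vector" and E :: "nat \<Rightarrow> real"
  assumes "c > 0" and nonneg: "\<And>k. 0 \<le> E k"
    and dec: "\<And>k. E (Suc k) \<le> E k - c * (norm (y (Suc k) - y k))\<^sup>2"
  shows "(\<lambda>k. y (Suc k) - y k) \<longlonglongrightarrow> 0"
proof -
  have "decseq E"
    using dec \<open>c > 0\<close> by (intro decseq_SucI) (smt (verit) mult_nonneg_nonneg zero_le_power2)
  then obtain L where L: "E \<longlonglongrightarrow> L"
    using decseq_convergent[of E 0] nonneg by blast
  have "(\<lambda>k. (E k - E (Suc k)) / c) \<longlonglongrightarrow> (L - L) / c"
    using \<open>c > 0\<close> by (intro tendsto_intros L LIMSEQ_Suc) auto
  then have lim: "(\<lambda>k. (E k - E (Suc k)) / c) \<longlonglongrightarrow> 0"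
    by simp
  have "(\<lambda>k. (norm (y (Suc k) - y k))\<^sup>2) \<longlonglongrightarrow> 0"
  proof (rule tendsto_sandwich[OF _ _ tendsto_const lim])
    show "\<forall>\<^sub>F k in sequentially. (norm (y (Suc k) - y k))\<^sup>2 \<le> (E k - E (Suc k)) / c"
      using dec \<open>c > 0\<close> by (intro always_eventually allI) (simp add: field_simps le_diff_eq)
  qed simp
  from tendsto_real_sqrt[OF this] show ?thesis
    by (simp add: tendsto_norm_zero_iff)
qed

theorem theorem3p7:
  fixes A :: "real ^ 'n ^ 'm" and b :: "real ^ 'm"
    and \<rho>1 \<rho>2 \<rho>3 \<gamma>1 \<gamma>2 \<delta>1 \<delta>2 lambda_star :: real
    and y :: "nat \<Rightarrow> real ^ 'n" and alpha lambda :: "nat \<Rightarrow> real"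
    and y_star :: "real ^ 'n"
  assumes "\<rho>1 \<in> {0<..<1}" "\<rho>2 \<in> {0<..<1}" "\<rho>3 \<in> {0<..<1}"
    and "\<gamma>1 > 0" "\<gamma>2 > 0" "\<delta>1 > 0" "\<delta>2 > 0"
    and "gpga_sequence A b \<rho>1 \<rho>2 \<rho>3 \<gamma>1 \<gamma>2 \<delta>1 \<delta>2 y alpha lambda"
    and "lambda \<longlonglongrightarrow> lambda_star"
    and "accumulation_point y y_star"
  shows "critical_point (Fobj A b lambda_star) y_star"
proof -
  have init: "y 0 \<in> sphere 0 1" "alpha 0 > 0" "lambda 0 > 0"
    and state: "\<And>k. inner_state A b \<rho>1 \<rho>2 \<rho>3 \<gamma>1 \<gamma>2 \<delta>1 \<delta>2 (alpha 0) (y k) (lambda k)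
            (alpha (Suc k)) (lambda (Suc k)) (y (Suc k))"
    and acc: "\<And>k. accept_test A b \<gamma>2 (y k) (lambda (Suc k)) (y (Suc k))"
    using assms(8) unfolding gpga_sequence_def by auto
  define \<beta> where "\<beta> = min (alpha 0) \<gamma>1"
  have \<beta>: "\<beta> > 0"
    using init(2) assms(4) by (simp add: \<beta>_def)
  have lam_pos: "0 < lambda k" for k
    by (induction k) (use init inner_state_bounds[OF state assms(3)] in auto)
  have prox: "prox_minimizer A b (y k) (alpha (Suc k)) (lambda (Suc k)) (y (Suc k))"
    and lam_dec: "lambda (Suc k) \<le> lambda k" and alpha_ge: "\<beta> \<le> alpha (Suc k)" for k
    using inner_state_bounds[OF state assms(3) lam_pos] by (auto simp: \<beta>_def)
  have sph: "y k \<in> sphere 0 1" for k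
  proof (cases k)
    case (Suc j)
    then show ?thesis
      using prox[of j] by (auto simp: prox_minimizer_def is_arg_min_def)
  qed (use init in simp)
  have step: "(\<lambda>k. y (Suc k) - y k) \<longlonglongrightarrow> 0"
  proof (rule sufficient_decrease_imp_steps_vanish
      [where E = "\<lambda>k. fobj A b (y k) + lambda k * norm1 (y k)" and c = "1/2 * \<gamma>2"])
    fix k
    show "0 \<le> fobj A b (y k) + lambda k * norm1 (y k)"
      using lam_pos[of k] norm1_nonneg[of "y k"] by (simp add: fobj_def)
    \<comment> \<open>The test evaluates both points with \<open>lambda (Suc k)\<close>, whereas the
      energy at \<open>k\<close> carries \<open>lambda k\<close>.\<close>
    have "lambda (Suc k) * norm1 (y k) \<le> lambda k * norm1 (y k)"
      by (intro mult_right_mono lam_dec norm1_nonneg)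
    with acc[of k] show "fobj A b (y (Suc k)) + lambda (Suc k) * norm1 (y (Suc k))
        \<le> fobj A b (y k) + lambda k * norm1 (y k) - 1/2 * \<gamma>2 * (norm (y (Suc k) - y k))\<^sup>2"
      by (simp add: accept_test_def Fobj_on_sphere[OF sph])
  qed (use assms(5) in simp)
  obtain r where r: "strict_mono r" and lim: "(\<lambda>k. y (r k)) \<longlonglongrightarrow> y_star"
    using assms(10) by (auto simp: accumulation_point_def o_def)
  \<comment> \<open>The model is centred at \<open>y (r k)\<close> but minimized at the next
    iterate, so both must reach the same limit.\<close>
  have "(\<lambda>k. (y (Suc (r k)) - y (r k)) + y (r k)) \<longlonglongrightarrow> 0 + y_star"
    using LIMSEQ_subseq_LIMSEQ[OF step r] by (intro tendsto_add lim) (simp add: o_def)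
  then have lim': "(\<lambda>k. y (Suc (r k))) \<longlonglongrightarrow> y_star"
    by simp
  have lim_lam: "(\<lambda>k. lambda (Suc (r k))) \<longlonglongrightarrow> lambda_star"
    using LIMSEQ_subseq_LIMSEQ[OF LIMSEQ_Suc[OF assms(9)] r] by (simp add: o_def)
  have lim_grad: "(\<lambda>k. grad (fobj A b) (y (r k))) \<longlonglongrightarrow> grad (fobj A b) y_star"
    by (rule isCont_tendsto_compose[OF isCont_grad_fobj lim])
  have star: "y_star \<in> sphere 0 1"
    using closed_sequentially[OF closed_sphere _ lim] sph by blast
  have min: "lambda_star * norm1 y_star
      \<le> (z - y_star) \<bullet> grad (fobj A b) y_star + 1 / (2 * \<beta>) * (norm (z - y_star))\<^sup>2
        + lambda_star * norm1 z" if z: "z \<in> sphere 0 1" for z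
  proof -
    \<comment> \<open>The vanishing inner product is kept so that the left side is literally the
      limit of the relaxed inequalities.\<close>
    have "(y_star - y_star) \<bullet> grad (fobj A b) y_star + lambda_star * norm1 y_star
      \<le> (z - y_star) \<bullet> grad (fobj A b) y_star + 1 / (2 * \<beta>) * (norm (z - y_star))\<^sup>2
        + lambda_star * norm1 z"
    proof (rule tendsto_le[OF sequentially_bot])
      show "\<forall>\<^sub>F k in sequentially.
        (y (Suc (r k)) - y (r k)) \<bullet> grad (fobj A b) (y (r k))
          + lambda (Suc (r k)) * norm1 (y (Suc (r k)))
        \<le> (z - y (r k)) \<bullet> grad (fobj A b) (y (r k))
          + 1 / (2 * \<beta>) * (norm (z - y (r k)))\<^sup>2 + lambda (Suc (r k)) * norm1 z"
        using prox_minimizer_relaxed[OF prox z \<beta> alpha_ge] by simp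
    qed (intro tendsto_intros lim lim' lim_lam lim_grad tendsto_norm1)+
    then show ?thesis
      by simp
  qed
  have "GDERIV (fobj A b) y_star :> grad (fobj A b) y_star"
    unfolding grad_fobj by (rule gderiv_fobj)
  from frechet_subdiff_indicator_sum[OF star this min]
  have "0 \<in> frechet_subdiff (Fobj A b lambda_star) y_star"
    by (simp add: Fobj_def[abs_def])
  then show ?thesis
    unfolding critical_point_def by (rule frechet_subdiff_imp_limiting_subdiff)
qed

end
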